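(* If $k\geq 4$ is an integer that is even or not divisible by $3$, then \[ f_2(k)\leq 2k(k+1)(k+2). \]
   Context: An $r$-coloring of a set $A\subseteq\mathbb{N}$ is a function $\Delta:A\to\{0,1,\ldots,r-1\}$. A tuple $(a_1,\ldots,a_k,b)$ of elements of $A$ is a monochromatic solution to an equation $G(x_1,\ldots,x_k,y)=0$ if $G(a_1,\ldots,a_k,b)=0$ and $\Delta(a_1)=\cdots=\Delta(a_k)=\Delta(b)$. For integers $r,k\geq 2$, $f_r(k)$ denotes the smallest positive integer $n$ such that every $r$-coloring of $\{1,2,\ldots,n\}$ has a monochromatic solution to $1/x_1+\cdots+1/x_k=1/y$, where $x_1,\ldots,x_k$ are not necessarily distinct. *)

theory Defs
  imports Complex_Main "HOL-Library.FuncSet" "HOL-Library.Extended_Nat"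
begin

definition coloring :: "nat \<Rightarrow> nat set \<Rightarrow> (nat \<Rightarrow> nat) \<Rightarrow> bool" where
  "coloring r A \<Delta> \<longleftrightarrow> \<Delta> \<in> A \<rightarrow> {0..<r}"

text \<open>An equation in the unknowns \<open>x 1, \<dots>, x k, y\<close> is given by the real-valued function \<open>G\<close>
  whose vanishing it expresses; the tuple \<open>(x 1, \<dots>, x k)\<close> is a function restricted to \<open>{1..k}\<close>.\<close>

definition monochromatic_solution ::
  "nat set \<Rightarrow> (nat \<Rightarrow> nat) \<Rightarrow> nat \<Rightarrow> ((nat \<Rightarrow> nat) \<Rightarrow> nat \<Rightarrow> real) \<Rightarrow> (nat \<Rightarrow> nat) \<Rightarrow> nat \<Rightarrow> bool" where
  "monochromatic_solution A \<Delta> k G x y \<longleftrightarrow>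
     (\<forall>i\<in>{1..k}. x i \<in> A) \<and> y \<in> A \<and> G x y = 0 \<and> (\<forall>i\<in>{1..k}. \<Delta> (x i) = \<Delta> y)"

definition unit_frac_eq :: "nat \<Rightarrow> (nat \<Rightarrow> nat) \<Rightarrow> nat \<Rightarrow> real" where
  "unit_frac_eq k x y = (\<Sum>i=1..k. 1 / real (x i)) - 1 / real y"

definition forces_solution :: "nat \<Rightarrow> nat \<Rightarrow> nat \<Rightarrow> bool" where
  "forces_solution r k n \<longleftrightarrow>
     (\<forall>\<Delta>. coloring r {1..n} \<Delta> \<longrightarrow>
        (\<exists>x y. monochromatic_solution {1..n} \<Delta> k (unit_frac_eq k) x y))"

text \<open>The value lies in \<^typ>\<open>enat\<close>, so that an upper bound on \<open>unit_frac_rado r k\<close> by a natural number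
  includes the existence of a suitable \<open>n\<close>: the infimum of the empty set is \<open>\<infinity>\<close>.\<close>

definition unit_frac_rado :: "nat \<Rightarrow> nat \<Rightarrow> enat" where
  "unit_frac_rado r k = Inf {enat n | n. 1 \<le> n \<and> forces_solution r k n}"

lemma unit_frac_rado_eq_enat_iff:
  "unit_frac_rado r k = enat n \<longleftrightarrow>
     1 \<le> n \<and> forces_solution r k n \<and> (\<forall>m. 1 \<le> m \<and> forces_solution r k m \<longrightarrow> n \<le> m)"
proof
  let ?S = "{enat n | n. 1 \<le> n \<and> forces_solution r k n}"
  assume *: "unit_frac_rado r k = enat n"
  then have "?S \<noteq> {}" unfolding unit_frac_rado_def Inf_enat_def by (metis enat.distinct(1) infinity_enat_def)
  then have "Inf ?S \<in> ?S" unfolding Inf_enat_def using LeastI_ex[of "\<lambda>x. x \<in> ?S"] by auto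
  then have "1 \<le> n \<and> forces_solution r k n" using * by (auto simp: unit_frac_rado_def)
  moreover have "n \<le> m" if "1 \<le> m" "forces_solution r k m" for m
  proof -
    have "Inf ?S \<le> enat m" by (rule Inf_lower) (use that in auto)
    then show ?thesis using * by (simp add: unit_frac_rado_def)
  qed
  ultimately show "1 \<le> n \<and> forces_solution r k n \<and>
    (\<forall>m. 1 \<le> m \<and> forces_solution r k m \<longrightarrow> n \<le> m)" by blast
next
  assume "1 \<le> n \<and> forces_solution r k n \<and> (\<forall>m. 1 \<le> m \<and> forces_solution r k m \<longrightarrow> n \<le> m)"
  then show "unit_frac_rado r k = enat n"
    unfolding unit_frac_rado_def by (intro antisym Inf_lower Inf_greatest) auto
qed

end

theory Submission
  imports Defs
begin

text \<open>
  Substituting \<open>x = M / u\<close> for a divisor \<open>u\<close> of \<open>M\<close> turns \<open>1/x\<^sub>1 + \<dots> + 1/x\<^sub>k = 1/y\<close> into the linear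
  equation \<open>u\<^sub>1 + \<dots> + u\<^sub>k = z\<close> in divisors of \<open>M\<close>, so it suffices that no 2-coloring of the divisors
  of \<open>M\<close> avoids monochromatic solutions of the latter. An avoiding coloring separates \<open>u\<close> from
  \<open>k u\<close>. If it gave \<open>2k\<close> and \<open>3k\<close> the same color, all sums of \<open>k\<close> terms \<open>2k\<close> and \<open>3k\<close> would have
  the other color, which is also that of \<open>2\<close> and \<open>3\<close>. But there are two such sums \<open>N\<close> and
  \<open>N + 2k = N + (k-3) \<cdot> 2 + 2 \<cdot> 3\<close>, a contradiction. So \<open>3k\<close> has the color of \<open>2\<close>, and from there
  the colors of a few more divisors are forced until none is left for the last one. If \<open>3\<close> does
  not divide \<open>k\<close>, this works for \<open>M = 2k(k+1)(k+2)\<close>; if \<open>6\<close> divides \<open>k\<close>, for \<open>M = 2k\<^sup>2(k+1)\<close>.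
\<close>

locale sum_avoiding =
  fixes k :: nat and S :: "nat set" and \<chi> :: "nat \<Rightarrow> 'c"
  assumes not_monochromatic_sum:
    "\<lbrakk>length us = k; set us \<subseteq> S; sum_list us \<in> S\<rbrakk> \<Longrightarrow> \<exists>u\<in>set us. \<chi> u \<noteq> \<chi> (sum_list us)"
begin

lemma sum_avoiding_comp_inj:
  assumes "inj_on f (\<chi> ` S)"
  shows "sum_avoiding k S (f \<circ> \<chi>)"
proof
  fix us
  assume us: "length us = k" "set us \<subseteq> S" "sum_list us \<in> S"
  then obtain u where u: "u \<in> set us" "\<chi> u \<noteq> \<chi> (sum_list us)"
    using not_monochromatic_sum by blast
  then have "f (\<chi> u) \<noteq> f (\<chi> (sum_list us))"
    using inj_on_eq_iff[OF assms, of "\<chi> u" "\<chi> (sum_list us)"] us by blast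
  with u show "\<exists>u\<in>set us. (f \<circ> \<chi>) u \<noteq> (f \<circ> \<chi>) (sum_list us)"
    by auto
qed

text \<open>The sum consists of \<open>k - q - r\<close> terms \<open>u\<close>, \<open>q\<close> terms \<open>v\<close> and \<open>r\<close> terms \<open>w\<close>; its value is
  written without truncated subtraction.\<close>

lemma not_monochromatic_three_terms:
  assumes "q + r \<le> k" and "{u, v, w, z} \<subseteq> S"
    and sum: "z + (q + r) * u = k * u + q * v + r * w"
  shows "\<not> (\<chi> u = \<chi> z \<and> \<chi> v = \<chi> z \<and> \<chi> w = \<chi> z)"
proof -
  let ?us = "replicate (k - (q + r)) u @ replicate q v @ replicate r w"
  have "k * u = (k - (q + r)) * u + (q + r) * u"
    using assms(1) by (metis add_mult_distrib le_add_diff_inverse2)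
  then have "sum_list ?us = z"
    using sum by (simp add: sum_list_replicate)
  moreover have "set ?us \<subseteq> {u, v, w}" "length ?us = k"
    using assms(1) by auto
  moreover have "{u, v, w} \<subseteq> S" "z \<in> S"
    using assms(2) by simp_all
  ultimately have "\<exists>x\<in>{u, v, w}. \<chi> x \<noteq> \<chi> z"
    using not_monochromatic_sum[of ?us] by blast
  then show ?thesis
    by blast
qed

lemma not_monochromatic_two_terms:
  assumes "q \<le> k" and "{u, v, z} \<subseteq> S" and "z + q * u = k * u + q * v"
  shows "\<not> (\<chi> u = \<chi> z \<and> \<chi> v = \<chi> z)"
  using not_monochromatic_three_terms[of q 0 u v v z] assms by simp

lemma color_mult_neq:
  assumes "u \<in> S" and "k * u \<in> S"
  shows "\<chi> (k * u) \<noteq> \<chi> u"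
  using not_monochromatic_two_terms[of 0 u u "k * u"] assms by auto

end

lemma unit_frac_eq_divisors:
  assumes "set us \<subseteq> {d. d dvd M}" and "sum_list us dvd M"
  shows "unit_frac_eq (length us) (\<lambda>i. M div us ! (i - 1)) (M div sum_list us) = 0"
proof -
  have recip: "1 / real (M div d) = real d / real M" if "d dvd M" for d
    using that by (simp add: real_of_nat_div)
  have "(\<Sum>i=1..length us. 1 / real (M div us ! (i - 1)))
      = (\<Sum>i<length us. 1 / real (M div us ! i))"
    by (rule sum.reindex_bij_witness[of _ Suc "\<lambda>i. i - 1"]) auto
  also have "\<dots> = (\<Sum>i<length us. real (us ! i) / real M)"
    using assms(1) by (intro sum.cong refl recip) (auto dest: nth_mem)
  also have "\<dots> = real (sum_list us) / real M"
    by (simp add: sum_divide_distrib sum_list_sum_nth atLeast0LessThan)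
  also have "\<dots> = 1 / real (M div sum_list us)"
    using recip[OF assms(2)] ..
  finally show ?thesis
    by (simp add: unit_frac_eq_def)
qed

lemma forces_solution_if_divisors:
  assumes "0 < M"
    and unavoidable: "\<And>\<chi>. coloring r {d. d dvd M} \<chi> \<Longrightarrow> \<not> sum_avoiding k {d. d dvd M} \<chi>"
  shows "forces_solution r k M"
  unfolding forces_solution_def
proof (intro allI impI)
  fix \<Delta>
  assume "coloring r {1..M} \<Delta>"
  have cofactor: "M div d \<in> {1..M}" if "d dvd M" for d
    using that \<open>0 < M\<close> by (auto simp: Suc_le_eq div_greater_zero_iff dvd_imp_le intro: Nat.gr0I)
  have "coloring r {d. d dvd M} (\<lambda>d. \<Delta> (M div d))"
    using \<open>coloring r {1..M} \<Delta>\<close> cofactor unfolding coloring_def by blast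
  then obtain us where us: "length us = k" "set us \<subseteq> {d. d dvd M}" "sum_list us dvd M"
      and mono: "\<forall>u\<in>set us. \<Delta> (M div u) = \<Delta> (M div sum_list us)"
    using unavoidable unfolding sum_avoiding_def by blast
  have "us ! (i - 1) \<in> set us" if "i \<in> {1..k}" for i
    using that us(1) by (auto intro: nth_mem)
  then have "monochromatic_solution {1..M} \<Delta> k (unit_frac_eq k)
      (\<lambda>i. M div us ! (i - 1)) (M div sum_list us)"
    using us mono cofactor unit_frac_eq_divisors[OF us(2,3)]
    unfolding monochromatic_solution_def by blast
  then show "\<exists>x y. monochromatic_solution {1..M} \<Delta> k (unit_frac_eq k) x y"
    by blast
qed

lemma unit_frac_rado_2_le_if_divisors:
  assumes "0 < M" and unavoidable: "\<And>\<chi> :: nat \<Rightarrow> bool. \<not> sum_avoiding k {d. d dvd M} \<chi>"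
  shows "unit_frac_rado 2 k \<le> enat M"
proof -
  have "\<not> sum_avoiding k {d. d dvd M} \<chi>" if "coloring 2 {d. d dvd M} \<chi>" for \<chi>
  proof -
    have "\<chi> ` {d. d dvd M} \<subseteq> {0..<2}"
      using that unfolding coloring_def by blast
    moreover have "inj_on (\<lambda>c :: nat. c = 0) {0..<2}"
      by (auto simp: inj_on_def)
    ultimately have "inj_on (\<lambda>c. c = 0) (\<chi> ` {d. d dvd M})"
      by (rule inj_on_subset[rotated])
    then show ?thesis
      using unavoidable sum_avoiding.sum_avoiding_comp_inj by blast
  qed
  then have "forces_solution 2 k M"
    using forces_solution_if_divisors[OF \<open>0 < M\<close>] by blast
  with \<open>0 < M\<close> show ?thesis
    unfolding unit_frac_rado_def by (intro Inf_lower) (auto simp: Suc_le_eq)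
qed

locale two_color_sum_avoiding = sum_avoiding k S \<chi>
  for k :: nat and S :: "nat set" and \<chi> :: "nat \<Rightarrow> bool"
begin

lemma color_3k_eq_color_2:
  assumes "3 \<le> k" and "s + 2 \<le> k"
    and S: "{2, 3, k * 2, k * 3, k * (2 * k + s), k * (2 * k + (s + 2))} \<subseteq> S"
  shows "\<chi> (k * 3) = \<chi> 2"
proof (rule ccontr)
  assume "\<chi> (k * 3) \<noteq> \<chi> 2"
  moreover have color_2k: "\<chi> (k * 2) \<noteq> \<chi> 2" and "\<chi> (k * 3) \<noteq> \<chi> 3"
    using color_mult_neq S by blast+
  ultimately have color_3k: "\<chi> (k * 3) = \<chi> (k * 2)" and color_3: "\<chi> 3 = \<chi> 2"
    by auto
  have color_sum: "\<chi> (k * (2 * k + t)) = \<chi> 2" if "t \<le> k" "k * (2 * k + t) \<in> S" for t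
  proof -
    have "k * (2 * k + t) + t * (k * 2) = k * (k * 2) + t * (k * 3)"
      by (simp add: algebra_simps)
    then show ?thesis
      using not_monochromatic_two_terms that S color_2k color_3k by blast
  qed
  have "\<chi> (k * (2 * k + s)) = \<chi> 2" "\<chi> (k * (2 * k + (s + 2))) = \<chi> 2"
    using color_sum[of s] color_sum[of "s + 2"] assms(2) S by simp_all
  moreover have "k * (2 * k + (s + 2)) + (2 + 1) * 2 = k * 2 + 2 * 3 + 1 * (k * (2 * k + s))"
    by (simp add: algebra_simps)
  moreover have "2 + 1 \<le> k"
    using assms(1) by simp
  ultimately show False
    using not_monochromatic_three_terms S color_3 by blast
qed

lemma eleven_terms_unavoidable:
  assumes "4 \<le> k"
    and S: "{1, 2, 3, k + 2, k * 2, k * 3, k * (k + 2), (k + 1) * (k + 2),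
      k * (2 * k + 2), k * (2 * k + 4), k * ((k + 1) * (k + 2))} \<subseteq> S"
  shows False
proof -
  have sums: "k * 3 + 1 * 2 = k * 2 + 1 * (k + 2)"
    "(k + 2) + 1 * 1 = k * 1 + 1 * 3"
    "(k + 1) * (k + 2) + (3 + 1) * 1 = k * 1 + 3 * 2 + 1 * (k * (k + 2))"
    "k * (2 * k + 4) + 1 * (k + 2) = k * (k + 2) + 1 * ((k + 1) * (k + 2))"
    "k * ((k + 1) * (k + 2)) + 1 * (k * (k + 2)) = k * (k * (k + 2)) + 1 * (k * (2 * k + 4))"
    by (simp_all add: algebra_simps)
  have le_k: "1 \<le> k" "3 + 1 \<le> k"
    using assms(1) by simp_all
  have color_3k: "\<chi> (k * 3) = \<chi> 2"
    using color_3k_eq_color_2[of 2] assms by simp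
  then have "\<chi> 3 \<noteq> \<chi> 2"
    using color_mult_neq S by blast
  moreover have color_k2: "\<chi> (k + 2) \<noteq> \<chi> 2"
    using not_monochromatic_two_terms[OF _ _ sums(1)] le_k S color_3k by blast
  ultimately have "\<chi> 1 = \<chi> 2"
    using not_monochromatic_two_terms[OF _ _ sums(2)] le_k S by blast
  moreover have color_kk2: "\<chi> (k * (k + 2)) = \<chi> 2"
    using color_mult_neq S color_k2 by blast
  ultimately have color_k1k2: "\<chi> ((k + 1) * (k + 2)) \<noteq> \<chi> 2"
    using not_monochromatic_three_terms[OF _ _ sums(3)] le_k S by blast
  have "\<chi> (k * (2 * k + 4)) = \<chi> 2"
    using not_monochromatic_two_terms[OF _ _ sums(4)] le_k S color_k2 color_k1k2 by blast
  moreover have "\<chi> (k * ((k + 1) * (k + 2))) = \<chi> 2"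
    using color_mult_neq S color_k1k2 by blast
  ultimately show False
    using not_monochromatic_two_terms[OF _ _ sums(5)] le_k S color_kk2 by blast
qed

lemma eight_terms_unavoidable:
  assumes "3 \<le> k" and "even k"
    and S: "{2, 3, 4, k * 2, k * 3, k * 4, k * (k * 2), k * (2 * k + 2)} \<subseteq> S"
  shows False
proof -
  obtain m where m: "k = 2 * m"
    using assms(2) by (rule evenE)
  have sums: "k * 3 + m * 2 = k * 2 + m * 4"
    "k * (k * 2) + ((m - 1) + 1) * 2 = k * 2 + (m - 1) * (k * 4) + 1 * (k * 3)"
    using m assms(1) by (cases m; simp add: algebra_simps)+
  have le_k: "m \<le> k" "(m - 1) + 1 \<le> k"
    using m assms(1) by simp_all
  have color_3k: "\<chi> (k * 3) = \<chi> 2"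
    using color_3k_eq_color_2[of 0] assms by (simp add: mult.commute)
  have color_2kk: "\<chi> (k * (k * 2)) = \<chi> 2"
    using color_mult_neq[of 2] color_mult_neq[of "k * 2"] S by blast
  have "\<chi> 4 \<noteq> \<chi> 2"
    using not_monochromatic_two_terms[OF _ _ sums(1)] le_k S color_3k by blast
  then have "\<chi> (k * 4) = \<chi> 2"
    using color_mult_neq S by blast
  then show False
    using not_monochromatic_three_terms[OF _ _ sums(2)] le_k S color_2kk color_3k by blast
qed

end

lemma unit_frac_rado_2_le_if_not_3_dvd:
  assumes "4 \<le> k" and "\<not> 3 dvd k"
  shows "unit_frac_rado 2 k \<le> enat (2 * k * (k + 1) * (k + 2))" (is "_ \<le> enat ?M")
proof (rule unit_frac_rado_2_le_if_divisors)
  show "0 < ?M"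
    using assms(1) by simp
  have "3 dvd k + 1 \<or> 3 dvd k + 2"
    using assms(2) by presburger
  then have "3 dvd (k + 1) * (k + 2)"
    by (metis dvd_mult dvd_mult2)
  then obtain t where t: "(k + 1) * (k + 2) = 3 * t"
    by (rule dvdE)
  have "?M = 2 * k * (3 * t)"
    by (simp only: mult.assoc t)
  then have "3 dvd ?M" "k * 3 dvd ?M"
    by simp_all
  moreover have "?M = 2 * (k * (k + 1) * (k + 2))" "?M = (k + 2) * (2 * k * (k + 1))"
    "?M = (k * 2) * ((k + 1) * (k + 2))" "?M = (k * (k + 2)) * (2 * (k + 1))"
    "?M = ((k + 1) * (k + 2)) * (2 * k)" "?M = (k * (2 * k + 2)) * (k + 2)"
    "?M = (k * (2 * k + 4)) * (k + 1)" "?M = (k * ((k + 1) * (k + 2))) * 2"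
    by (simp_all add: algebra_simps)
  note this[THEN dvdI]
  ultimately have "{1, 2, 3, k + 2, k * 2, k * 3, k * (k + 2), (k + 1) * (k + 2),
      k * (2 * k + 2), k * (2 * k + 4), k * ((k + 1) * (k + 2))} \<subseteq> {d. d dvd ?M}"
    by (simp only: insert_subset empty_subsetI mem_Collect_eq one_dvd simp_thms)
  then show "\<not> sum_avoiding k {d. d dvd ?M} \<chi>" for \<chi> :: "nat \<Rightarrow> bool"
    using two_color_sum_avoiding.eleven_terms_unavoidable[OF two_color_sum_avoiding.intro] assms(1)
    by blast
qed

lemma unit_frac_rado_2_le_if_even:
  assumes "3 \<le> k" and "even k" and "3 dvd k * (k + 1)"
  shows "unit_frac_rado 2 k \<le> enat (2 * k\<^sup>2 * (k + 1))" (is "_ \<le> enat ?M")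
proof (rule unit_frac_rado_2_le_if_divisors)
  show "0 < ?M"
    using assms(1) by simp
  obtain m where m: "k = 2 * m"
    using assms(2) by (rule evenE)
  obtain t where t: "k * (k + 1) = 3 * t"
    using assms(3) by (rule dvdE)
  have "?M = 2 * k * (k * (k + 1))"
    by (simp add: power2_eq_square algebra_simps)
  then have "?M = 2 * k * (3 * t)"
    by (simp only: t)
  then have "3 dvd ?M" "k * 3 dvd ?M"
    by simp_all
  moreover have "?M = 2 * (k\<^sup>2 * (k + 1))" "?M = 4 * (m * k * (k + 1))"
    "?M = (k * 2) * (k * (k + 1))" "?M = (k * 4) * (m * (k + 1))"
    "?M = (k * (k * 2)) * (k + 1)" "?M = (k * (2 * k + 2)) * k"
    by (simp_all add: m power2_eq_square algebra_simps)
  note this[THEN dvdI]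
  ultimately have "{2, 3, 4, k * 2, k * 3, k * 4, k * (k * 2), k * (2 * k + 2)} \<subseteq> {d. d dvd ?M}"
    by (simp only: insert_subset empty_subsetI mem_Collect_eq one_dvd simp_thms)
  then show "\<not> sum_avoiding k {d. d dvd ?M} \<chi>" for \<chi> :: "nat \<Rightarrow> bool"
    using two_color_sum_avoiding.eight_terms_unavoidable[OF two_color_sum_avoiding.intro] assms(1,2)
    by blast
qed

theorem theorem3p3:
  fixes k :: nat
  assumes "k \<ge> 4" and "even k \<or> \<not> 3 dvd k"
  shows "unit_frac_rado 2 k \<le> enat (2 * k * (k + 1) * (k + 2))"
proof (cases "3 dvd k")
  case True
  then have "unit_frac_rado 2 k \<le> enat (2 * k\<^sup>2 * (k + 1))"
    using assms by (intro unit_frac_rado_2_le_if_even) auto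
  also have "\<dots> \<le> enat (2 * k * (k + 1) * (k + 2))"
    by (simp add: power2_eq_square algebra_simps)
  finally show ?thesis .
next
  case False
  with assms(1) show ?thesis
    by (rule unit_frac_rado_2_le_if_not_3_dvd)
qed

end
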